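(* Let $(X,d_X)$ be a connected and locally path-connected Polish metric space, $p\ge 1$, and $\theta\colon X\times X\to\mathbb{R}$ an $L$-admissible pseudo-metric, $L>0$. Let $\mu,\mu'\in\mathcal{B}(X,d_X;p)$, and let $\mathcal{F}_p=(T_p,d_p,\mu_p,\kappa_p)$ and $\mathcal{F}'_p=(T'_p,d'_p,\mu'_p,\kappa'_p)$ be the functional barycentric merge trees of order $p$ of $(X,d_X,\mu)$ and $(X,d_X,\mu')$, both constructed with respect to $\theta$. If $K\ge 1$ is a connectivity constant for $(X,d_X)$, then $$D_{KS,p}(\mathcal{F}_p,\mathcal{F}'_p)\le L(1+K)\,w_p(\mu,\mu').$$ In particular, $D_{KS,p}(\mathcal{F}_p,\mathcal{F}'_p)\le 2\,w_p(\mu,\mu')$ if $(X,d_X)$ is a geodesic space and $\theta=d_X$.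
   Context: $\mathcal{B}(X,d_X;p)$ is the set of Borel probability measures $\mu$ on $X$ with $\int_X d_X^p(x_0,y)\,d\mu(y)<\infty$ for some (hence all) $x_0\in X$. A pseudo-metric $\theta$ on $X$ is $L$-admissible if $\theta(x,y)\le L\,d_X(x,y)$ for all $x,y$. $a\vee b$ and $a\wedge b$ denote max and min; $I=[0,1]$; $\Gamma(x,y)$ is the set of continuous paths $\gamma\colon I\to(X,d_X)$ with $\gamma(0)=x$, $\gamma(1)=y$. Connectivity constant: $K>0$ is a connectivity constant for $(X,d_X)$ if $r_X(x,y)\le K d_X(x,y)$ for all $x,y\in X$, where $r_X(x,y)=\inf_{\gamma\in\Gamma(x,y)}\sup_{t\in I} d_X(x,\gamma(t))\vee d_X(\gamma(t),y)$. Barycentric merge tree (BMT): for $\mu\in\mathcal{B}(X,d_X;p)$ the $p$-deviation function is $\sigma_p(x)=\big(\int_X\theta^p(x,y)\,d\mu(y)\big)^{1/p}$. Let $A(t)=\sigma_p^{-1}((-\infty,t])$. $T_p$ is the quotient of $X$ by: $x\sim y$ iff there is $t\in\mathbb{R}$ with $\sigma_p(x)=\sigma_p(y)=t$ and $x,y$ in the same connected component of $A(t)$. $\alpha_p\colon X\to T_p$ is the quotient map and $\kappa_p\colon T_p\to\mathbb{R}$ is the induced function, $\sigma_p=\kappa_p\circ\alpha_p$. For $a=\alpha_p(x)$, $C_a$ is the connected component of $A(\sigma_p(x))$ containing $x$; $a\preceq b$ iff $C_a\subseteq C_b$; $\Lambda(a,b)=\{c\in T_p: a\preceq c,\ b\preceq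 c\}$. $T_p$ carries the pseudo-metric $d_p(a,b)=\inf_{c\in\Lambda(a,b)}(\kappa_p(c)-\kappa_p(a))\vee(\kappa_p(c)-\kappa_p(b))$, its topology, and the pushforward measure $\mu_p=(\alpha_p)_\sharp\mu$. The functional BMT is $(T_p,d_p,\mu_p,\kappa_p)$. Primed objects are those for $\mu'$. Wasserstein distance: $w_p(\mu,\mu')=\inf_{h\in C(\mu,\mu')}\big(\int_{X\times X} d_X^p(x,y)\,dh(x,y)\big)^{1/p}$, where $C(\mu,\mu')$ is the set of couplings (Borel probability measures on the product with marginals $\mu,\mu'$). Functional Kantorovich–Sturm distance: for (pseudo) metric measure spaces with functions $\mathcal{F}=(Z,d,\mu,f)$, $\mathcal{F}'=(Z',d',\mu',f')$, let $A,A'$ be the supports of $\mu,\mu'$. A metric coupling is a (pseudo) metric $\delta$ on $Z\sqcup Z'$ with $\delta|_{A\times A}=d|_{A\times A}$ and $\delta|_{A'\times A'}=d'|_{A'\times A'}$; $M(\mathcal{Z},\mathcal{Z}')$ is the set of these. Then (possibly infinite) $$D_{KS,p}(\mathcal{F},\mathcal{F}')=\inf_{h\in C(\mu,\mu'),\,\delta\in M(\mathcal{Z},\mathcal{Z}')}\Big(\int_{Z\times Z'}\delta^p(z,z')\,dh\Big)^{1/p}\vee\Big(\int_{Z\times Z'}|f(z)-f'(z')|^p\,dh\Big)^{1/p}.$$ *)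

theory Defs
  imports "HOL-Probability.Probability"
begin

section \<open>Pseudo-metrics and Borel measures\<close>

definition pseudometric_on :: "'z set \<Rightarrow> ('z \<Rightarrow> 'z \<Rightarrow> real) \<Rightarrow> bool" where
  "pseudometric_on Z d \<longleftrightarrow>
     (\<forall>x\<in>Z. \<forall>y\<in>Z. 0 \<le> d x y) \<and>
     (\<forall>x\<in>Z. d x x = 0) \<and>
     (\<forall>x\<in>Z. \<forall>y\<in>Z. d x y = d y x) \<and>
     (\<forall>x\<in>Z. \<forall>y\<in>Z. \<forall>z\<in>Z. d x z \<le> d x y + d y z)"

definition admissible :: "real \<Rightarrow> ('a::metric_space \<Rightarrow> 'a \<Rightarrow> real) \<Rightarrow> bool" where
  "admissible L \<theta> \<longleftrightarrow> pseudometric_on UNIV \<theta> \<and> (\<forall>x y. \<theta> x y \<le> L * dist x y)"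

text \<open>The library's \<^const>\<open>Metric_space.mtopology\<close> is available for genuine metrics only.\<close>

definition pm_topology :: "'z set \<Rightarrow> ('z \<Rightarrow> 'z \<Rightarrow> real) \<Rightarrow> 'z topology" where
  "pm_topology Z d =
     topology (\<lambda>U. U \<subseteq> Z \<and> (\<forall>x\<in>U. \<exists>e>0. \<forall>y\<in>Z. d x y < e \<longrightarrow> y \<in> U))"

lemma openin_pm_topology:
  "openin (pm_topology Z d) U \<longleftrightarrow> U \<subseteq> Z \<and> (\<forall>x\<in>U. \<exists>e>0. \<forall>y\<in>Z. d x y < e \<longrightarrow> y \<in> U)"
proof -
  have "istopology (\<lambda>U. U \<subseteq> Z \<and> (\<forall>x\<in>U. \<exists>e>0. \<forall>y\<in>Z. d x y < e \<longrightarrow> y \<in> U))"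
    unfolding istopology_def
  proof (intro conjI allI impI)
    fix S T
    assume S: "S \<subseteq> Z \<and> (\<forall>x\<in>S. \<exists>e>0. \<forall>y\<in>Z. d x y < e \<longrightarrow> y \<in> S)"
      and T: "T \<subseteq> Z \<and> (\<forall>x\<in>T. \<exists>e>0. \<forall>y\<in>Z. d x y < e \<longrightarrow> y \<in> T)"
    show "S \<inter> T \<subseteq> Z" using S by blast
    show "\<forall>x\<in>S \<inter> T. \<exists>e>0. \<forall>y\<in>Z. d x y < e \<longrightarrow> y \<in> S \<inter> T"
    proof
      fix x assume x: "x \<in> S \<inter> T"
      obtain e1 where e1: "e1 > 0" "\<forall>y\<in>Z. d x y < e1 \<longrightarrow> y \<in> S"
        using S x by blast
      obtain e2 where e2: "e2 > 0" "\<forall>y\<in>Z. d x y < e2 \<longrightarrow> y \<in> T"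
        using T x by blast
      show "\<exists>e>0. \<forall>y\<in>Z. d x y < e \<longrightarrow> y \<in> S \<inter> T"
        using e1 e2 by (intro exI[of _ "min e1 e2"]) auto
    qed
  next
    fix \<U>
    assume U: "\<forall>S\<in>\<U>. S \<subseteq> Z \<and> (\<forall>x\<in>S. \<exists>e>0. \<forall>y\<in>Z. d x y < e \<longrightarrow> y \<in> S)"
    show "\<Union>\<U> \<subseteq> Z" using U by (simp add: Union_least)
    show "\<forall>x\<in>\<Union>\<U>. \<exists>e>0. \<forall>y\<in>Z. d x y < e \<longrightarrow> y \<in> \<Union>\<U>"
    proof
      fix x assume "x \<in> \<Union>\<U>"
      then obtain S where S: "S \<in> \<U>" "x \<in> S" by (rule UnionE)
      from U[rule_format, OF S(1)] S(2)
      obtain e where e: "e > 0" "\<forall>y\<in>Z. d x y < e \<longrightarrow> y \<in> S" by blast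
      show "\<exists>e>0. \<forall>y\<in>Z. d x y < e \<longrightarrow> y \<in> \<Union>\<U>"
        using e S(1) by (intro exI[of _ e] conjI ballI impI UnionI[OF S(1)]) simp_all
    qed
  qed
  then show ?thesis
    unfolding pm_topology_def by (simp only: topology_inverse')
qed

lemma topspace_pm_topology [simp]: "topspace (pm_topology Z d) = Z"
proof
  show "topspace (pm_topology Z d) \<subseteq> Z"
    using openin_topspace[of "pm_topology Z d"] unfolding openin_pm_topology by (rule conjunct1)
  have "openin (pm_topology Z d) Z"
    unfolding openin_pm_topology by (intro conjI ballI exI[of _ 1]) simp_all
  then show "Z \<subseteq> topspace (pm_topology Z d)"
    by (rule openin_subset)
qed

definition borel_of :: "'z topology \<Rightarrow> 'z measure" where
  "borel_of T = sigma (topspace T) {U. openin T U}"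

definition msupport :: "'z topology \<Rightarrow> 'z measure \<Rightarrow> 'z set" where
  "msupport T \<mu> = {z \<in> topspace T. \<forall>U. openin T U \<and> z \<in> U \<longrightarrow> 0 < emeasure \<mu> U}"

definition couplings ::
  "'z topology \<Rightarrow> 'w topology \<Rightarrow> 'z measure \<Rightarrow> 'w measure \<Rightarrow> ('z \<times> 'w) measure set" where
  "couplings T T' \<mu> \<mu>' =
     {h. prob_space h \<and> sets h = sets (borel_of (prod_topology T T')) \<and>
         distr h (borel_of T) fst = \<mu> \<and> distr h (borel_of T') snd = \<mu>'}"

text \<open>The power \<open>c\<^sup>1\<^sup>/\<^sup>p\<close> on \<open>[0,\<infinity>]\<close>, for \<open>p > 0\<close>.\<close>

definition ennroot :: "real \<Rightarrow> ennreal \<Rightarrow> ennreal" where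
  "ennroot p c = (if c = \<infinity> then \<infinity> else ennreal (enn2real c powr (1 / p)))"

section \<open>The underlying space\<close>

definition finite_moment_measures :: "real \<Rightarrow> ('a::metric_space) measure set" where
  "finite_moment_measures p =
     {\<mu>. prob_space \<mu> \<and> sets \<mu> = sets borel \<and>
         (\<exists>x0. (\<integral>\<^sup>+ y. ennreal (dist x0 y powr p) \<partial>\<mu>) < \<infinity>)}"

definition wasserstein :: "real \<Rightarrow> ('a::metric_space) measure \<Rightarrow> 'a measure \<Rightarrow> ennreal" where
  "wasserstein p \<mu> \<mu>' =
     (INF h \<in> couplings euclidean euclidean \<mu> \<mu>'.
        ennroot p (\<integral>\<^sup>+ z. ennreal (dist (fst z) (snd z) powr p) \<partial>h))"

text \<open>With values in \<open>[0,\<infinity>]\<close>, so that the infimum is \<open>\<infinity>\<close> if no path joins \<open>x\<close> and \<open>y\<close>.\<close>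

definition path_radius :: "('a::metric_space) \<Rightarrow> 'a \<Rightarrow> ennreal" where
  "path_radius x y =
     (INF \<gamma> \<in> {\<gamma>. path \<gamma> \<and> pathstart \<gamma> = x \<and> pathfinish \<gamma> = y}.
        SUP t \<in> {0..1}. ennreal (max (dist x (\<gamma> t)) (dist (\<gamma> t) y)))"

definition connectivity_constant :: "('a::metric_space) itself \<Rightarrow> real \<Rightarrow> bool" where
  "connectivity_constant _ K \<longleftrightarrow>
     K > 0 \<and> (\<forall>x y::'a. path_radius x y \<le> ennreal (K * dist x y))"

definition geodesic_space :: "('a::metric_space) itself \<Rightarrow> bool" where
  "geodesic_space _ \<longleftrightarrow>
     (\<forall>x y::'a. \<exists>\<gamma>::real \<Rightarrow> 'a. \<gamma> 0 = x \<and> \<gamma> 1 = y \<and>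
        (\<forall>s\<in>{0..1}. \<forall>t\<in>{0..1}. dist (\<gamma> s) (\<gamma> t) = \<bar>s - t\<bar> * dist x y))"

section \<open>Functional (pseudo) metric measure spaces\<close>

record 'z fmm_space =
  fmm_pts :: "'z set"
  fmm_dist :: "'z \<Rightarrow> 'z \<Rightarrow> real"
  fmm_meas :: "'z measure"
  fmm_fun :: "'z \<Rightarrow> real"

definition fmm_top :: "'z fmm_space \<Rightarrow> 'z topology" where
  "fmm_top F = pm_topology (fmm_pts F) (fmm_dist F)"

definition fmm_support :: "'z fmm_space \<Rightarrow> 'z set" where
  "fmm_support F = msupport (fmm_top F) (fmm_meas F)"

definition metric_couplings ::
  "'z fmm_space \<Rightarrow> 'w fmm_space \<Rightarrow> ('z + 'w \<Rightarrow> 'z + 'w \<Rightarrow> real) set" where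
  "metric_couplings F F' =
     {\<delta>. pseudometric_on (fmm_pts F <+> fmm_pts F') \<delta> \<and>
         (\<forall>x\<in>fmm_support F. \<forall>y\<in>fmm_support F. \<delta> (Inl x) (Inl y) = fmm_dist F x y) \<and>
         (\<forall>x\<in>fmm_support F'. \<forall>y\<in>fmm_support F'. \<delta> (Inr x) (Inr y) = fmm_dist F' x y)}"

definition D_KS :: "real \<Rightarrow> 'z fmm_space \<Rightarrow> 'w fmm_space \<Rightarrow> ennreal" where
  "D_KS p F F' =
     (INF h \<in> couplings (fmm_top F) (fmm_top F') (fmm_meas F) (fmm_meas F').
      INF \<delta> \<in> metric_couplings F F'.
        max (ennroot p (\<integral>\<^sup>+ z. ennreal (\<delta> (Inl (fst z)) (Inr (snd z)) powr p) \<partial>h))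
            (ennroot p (\<integral>\<^sup>+ z. ennreal (\<bar>fmm_fun F (fst z) - fmm_fun F' (snd z)\<bar> powr p) \<partial>h)))"

section \<open>Barycentric merge trees\<close>

definition deviation ::
  "real \<Rightarrow> ('a \<Rightarrow> 'a \<Rightarrow> real) \<Rightarrow> 'a measure \<Rightarrow> 'a \<Rightarrow> real" where
  "deviation p \<theta> \<mu> x = (\<integral>y. \<theta> x y powr p \<partial>\<mu>) powr (1 / p)"

definition sublevel :: "('a \<Rightarrow> real) \<Rightarrow> real \<Rightarrow> 'a set" where
  "sublevel f t = f -` {..t}"

definition merge_rel :: "('a::topological_space \<Rightarrow> real) \<Rightarrow> ('a \<times> 'a) set" where
  "merge_rel f =
     {(x, y). \<exists>t. f x = t \<and> f y = t \<and> connected_component (sublevel f t) x y}"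

definition merge_tree :: "('a::topological_space \<Rightarrow> real) \<Rightarrow> 'a set set" where
  "merge_tree f = UNIV // merge_rel f"

definition mt_proj :: "('a::topological_space \<Rightarrow> real) \<Rightarrow> 'a \<Rightarrow> 'a set" where
  "mt_proj f x = merge_rel f `` {x}"

text \<open>The induced function: the unique value of \<open>f\<close> on the class \<open>a\<close>.\<close>

definition mt_height :: "('a \<Rightarrow> real) \<Rightarrow> 'a set \<Rightarrow> real" where
  "mt_height f a = the_elem (f ` a)"

text \<open>All members of the union coincide, since the points of a class \<open>a\<close> lie at the same
  level and in the same component of the sublevel set.\<close>

definition mt_component :: "('a::topological_space \<Rightarrow> real) \<Rightarrow> 'a set \<Rightarrow> 'a set" where
  "mt_component f a = (\<Union>x\<in>a. connected_component_set (sublevel f (f x)) x)"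

definition mt_le :: "('a::topological_space \<Rightarrow> real) \<Rightarrow> 'a set \<Rightarrow> 'a set \<Rightarrow> bool" where
  "mt_le f a b \<longleftrightarrow> mt_component f a \<subseteq> mt_component f b"

definition mt_upper :: "('a::topological_space \<Rightarrow> real) \<Rightarrow> 'a set \<Rightarrow> 'a set \<Rightarrow> 'a set set" where
  "mt_upper f a b = {c \<in> merge_tree f. mt_le f a c \<and> mt_le f b c}"

definition mt_dist :: "('a::topological_space \<Rightarrow> real) \<Rightarrow> 'a set \<Rightarrow> 'a set \<Rightarrow> real" where
  "mt_dist f a b =
     (INF c \<in> mt_upper f a b. max (mt_height f c - mt_height f a) (mt_height f c - mt_height f b))"

text \<open>The tree carries the topology of its pseudo-metric \<^const>\<open>mt_dist\<close>, and the Borel sets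
  of that topology.\<close>

definition bmt ::
  "real \<Rightarrow> ('a::topological_space \<Rightarrow> 'a \<Rightarrow> real) \<Rightarrow> 'a measure \<Rightarrow> 'a set fmm_space" where
  "bmt p \<theta> \<mu> =
     (let \<sigma> = deviation p \<theta> \<mu>; T = merge_tree \<sigma>; d = mt_dist \<sigma> in
      \<lparr>fmm_pts = T,
       fmm_dist = d,
       fmm_meas = distr \<mu> (borel_of (pm_topology T d)) (mt_proj \<sigma>),
       fmm_fun = mt_height \<sigma>\<rparr>)"

end

theory Submission
  imports Defs
begin

text \<open>
  For a merge tree, \<open>d(\<alpha>(x), \<alpha>(y)) = m(x, y) - min (\<sigma>(x)) (\<sigma>(y))\<close>, where \<open>m(x, y)\<close> is the infimum of
  all \<open>s\<close> such that \<open>x\<close> and \<open>y\<close> lie in a connected set on which \<open>\<sigma> \<le> s\<close>. Let \<open>h\<close> be a coupling of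
  \<open>\<mu>\<close> and \<open>\<mu>'\<close> with cost \<open>W\<close>. By Minkowski's inequality \<open>|\<sigma> - \<sigma>'| \<le> L W =: r\<close> pointwise, so the pulled
  back tree metrics on \<open>X\<close> differ by at most \<open>2 r\<close>, and
  \<open>\<delta>(a, b) = inf\<^sub>x (d(a, \<alpha>(x)) + r + d'(\<alpha>'(x), b))\<close> is a metric coupling of the trees. Paths of small
  radius give \<open>d'(\<alpha>'(x), \<alpha>'(y)) \<le> L K d\<^sub>X(x, y)\<close>, whence \<open>\<delta>(\<alpha>(x), \<alpha>'(y)) \<le> r + L K d\<^sub>X(x, y)\<close>; the same
  bound holds for \<open>|\<sigma>(x) - \<sigma>'(y)|\<close> as \<open>K \<ge> 1\<close>. Minkowski's inequality for the image of \<open>h\<close> on the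
  product of the trees yields \<open>L (1 + K) W\<close>.
\<close>

section \<open>L^p norms with values in [0, infinity] and Minkowski's inequality\<close>

section \<open>Integrals of powers\<close>

text \<open>For positive \<open>u\<close> and \<open>v\<close> this is convexity of the power
  function. If one of them vanishes, it reduces to t^p \<le> t for 0 < t \<le> 1.\<close>

lemma powr_convex_comb:
  fixes u v s t p :: real
  assumes "1 \<le> p" "0 \<le> u" "0 \<le> v" "0 < s" "0 < t" "s + t = 1"
  shows "(s * u + t * v) powr p \<le> s * u powr p + t * v powr p"
proof -
  have *: "(t * v) powr p \<le> t * v powr p" if "0 < t" "t \<le> 1" "0 \<le> v" for t v :: real
  proof -
    have "t powr p \<le> t powr 1"
      using that assms(1) by (intro powr_mono') auto
    then show ?thesis
      using that by (simp add: powr_mult mult_right_mono)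
  qed
  show ?thesis
  proof (cases "u = 0 \<or> v = 0")
    case True
    then show ?thesis
      using *[of t v] *[of s u] assms by auto
  next
    case False
    then show ?thesis
      using convex_onD[OF powr_convex[OF assms(1)], of t u v] assms by (simp add: eq_diff_eq[symmetric])
  qed
qed

text \<open>Trades a bound on a norm for a bound on an integral. If \<open>c\<close> is infinite,
  both sides are false.\<close>

lemma ennroot_le_iff:
  assumes "0 < p" "0 \<le> A"
  shows "ennroot p c \<le> ennreal A \<longleftrightarrow> c \<le> ennreal (A powr p)"
proof (cases c)
  case (real r)
  have "r powr (1 / p) \<le> A \<longleftrightarrow> r \<le> A powr p"
  proof
    assume "r powr (1 / p) \<le> A"
    then have "(r powr (1 / p)) powr p \<le> A powr p"
      using assms by (intro powr_mono2) auto
    then show "r \<le> A powr p"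
      using assms real by (simp add: powr_powr)
  next
    assume "r \<le> A powr p"
    then have "r powr (1 / p) \<le> (A powr p) powr (1 / p)"
      using assms real by (intro powr_mono2) auto
    then show "r powr (1 / p) \<le> A"
      using assms by (simp add: powr_powr)
  qed
  then show ?thesis
    using real assms by (simp add: ennroot_def ennreal_le_iff)
next
  case top
  then show ?thesis
    by (simp add: ennroot_def top_unique)
qed

text \<open>Minkowski's inequality: divide by the norms and use convexity of \<open>x \<mapsto> x\<^sup>p\<close> pointwise.\<close>

lemma ennroot_nn_integral_add_le:
  fixes f g :: "'b \<Rightarrow> real"
  assumes p: "1 \<le> p" and [measurable]: "f \<in> borel_measurable M" "g \<in> borel_measurable M"
    and nn: "\<And>x. 0 \<le> f x" "\<And>x. 0 \<le> g x" "0 \<le> A" "0 \<le> B"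
    and f: "ennroot p (\<integral>\<^sup>+ x. ennreal (f x powr p) \<partial>M) \<le> ennreal A"
    and g: "ennroot p (\<integral>\<^sup>+ x. ennreal (g x powr p) \<partial>M) \<le> ennreal B"
  shows "ennroot p (\<integral>\<^sup>+ x. ennreal ((f x + g x) powr p) \<partial>M) \<le> ennreal (A + B)"
proof (rule ennreal_le_epsilon)
  fix e :: real
  assume "0 < e"
  \<comment> \<open>Adding \<open>e / 2\<close> makes both numbers positive, so that
    \<open>f\<close> and \<open>g\<close> can be divided by them even if \<open>A\<close> or
    \<open>B\<close> is 0.\<close>
  define a b where "a = A + e / 2" and "b = B + e / 2"
  have ab: "0 < a" "0 < b" "a + b = A + B + e"
    using nn \<open>0 < e\<close> by (auto simp: a_def b_def)
  have fa: "(\<integral>\<^sup>+ x. ennreal (f x powr p) \<partial>M) \<le> ennreal (a powr p)"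
    using p f nn \<open>0 < e\<close> ab
    by (subst ennroot_le_iff[symmetric]) (auto intro: order_trans[OF f] simp: a_def ennreal_leI)
  have gb: "(\<integral>\<^sup>+ x. ennreal (g x powr p) \<partial>M) \<le> ennreal (b powr p)"
    using p g nn \<open>0 < e\<close> ab
    by (subst ennroot_le_iff[symmetric]) (auto intro: order_trans[OF g] simp: b_def ennreal_leI)
  define c where "c = (a + b) powr p"
  \<comment> \<open>These are the coefficients that arise when \<open>f / a\<close> and
    \<open>g / b\<close> are combined with weights a/(a+b) and b/(a+b). They satisfy k a^p + l b^p =
    c.\<close>
  define k l where "k = c * (a / (a + b)) / a powr p" and "l = c * (b / (a + b)) / b powr p"
  have kl: "0 \<le> k" "0 \<le> l"
    using ab by (auto simp: k_def l_def c_def)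
  have pt: "(f x + g x) powr p \<le> k * f x powr p + l * g x powr p" for x
  proof -
    have "f x + g x = (a + b) * (a / (a + b) * (f x / a) + b / (a + b) * (g x / b))"
      using ab(1,2) by (simp add: distrib_left)
    then have "(f x + g x) powr p = c * (a / (a + b) * (f x / a) + b / (a + b) * (g x / b)) powr p"
      using ab(1,2) nn by (simp add: powr_mult c_def)
    also have "\<dots> \<le> c * (a / (a + b) * (f x / a) powr p + b / (a + b) * (g x / b) powr p)"
      using ab(1,2) nn
      by (intro mult_left_mono powr_convex_comb p) (auto simp: c_def add_divide_distrib[symmetric])
    also have "\<dots> = k * f x powr p + l * g x powr p"
      using ab nn by (simp add: k_def l_def powr_divide algebra_simps)
    finally show ?thesis .
  qed
  have "(\<integral>\<^sup>+ x. ennreal ((f x + g x) powr p) \<partial>M)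
      \<le> (\<integral>\<^sup>+ x. ennreal k * ennreal (f x powr p) + ennreal l * ennreal (g x powr p) \<partial>M)"
    using pt kl by (intro nn_integral_mono)
      (auto simp: ennreal_mult[symmetric] ennreal_plus[symmetric] simp del: ennreal_plus)
  also have "\<dots> = ennreal k * (\<integral>\<^sup>+ x. ennreal (f x powr p) \<partial>M)
      + ennreal l * (\<integral>\<^sup>+ x. ennreal (g x powr p) \<partial>M)"
    by (simp add: nn_integral_add nn_integral_cmult)
  also have "\<dots> \<le> ennreal k * ennreal (a powr p) + ennreal l * ennreal (b powr p)"
    by (intro add_mono mult_left_mono fa gb) auto
  also have "\<dots> = ennreal (k * a powr p + l * b powr p)"
    using kl by (simp add: ennreal_mult)
  also have "k * a powr p + l * b powr p = c"
    using ab(1,2) by (simp add: k_def l_def add_divide_distrib[symmetric] distrib_left[symmetric])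
  finally have "ennroot p (\<integral>\<^sup>+ x. ennreal ((f x + g x) powr p) \<partial>M) \<le> ennreal (a + b)"
    using p ab by (subst ennroot_le_iff) (auto simp: c_def)
  then show "ennroot p (\<integral>\<^sup>+ x. ennreal ((f x + g x) powr p) \<partial>M) \<le> ennreal (A + B) + ennreal e"
    using nn ab \<open>0 < e\<close> by (simp add: ennreal_plus[symmetric] del: ennreal_plus)
qed

lemma ennroot_nn_integral_const:
  assumes "prob_space M" "0 < p" "0 \<le> c"
  shows "ennroot p (\<integral>\<^sup>+ x. ennreal (c powr p) \<partial>M) \<le> ennreal c"
  using assms by (subst ennroot_le_iff) (auto simp: prob_space.emeasure_space_1)

lemma ennroot_nn_integral_cmult:
  assumes "0 < p" "0 \<le> c" "0 \<le> A" "\<And>x. 0 \<le> f x" and [measurable]: "f \<in> borel_measurable M"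
    and f: "ennroot p (\<integral>\<^sup>+ x. ennreal (f x powr p) \<partial>M) \<le> ennreal A"
  shows "ennroot p (\<integral>\<^sup>+ x. ennreal ((c * f x) powr p) \<partial>M) \<le> ennreal (c * A)"
proof -
  have "(\<integral>\<^sup>+ x. ennreal ((c * f x) powr p) \<partial>M)
      = ennreal (c powr p) * (\<integral>\<^sup>+ x. ennreal (f x powr p) \<partial>M)"
    using assms by (simp add: powr_mult ennreal_mult nn_integral_cmult)
  also have "\<dots> \<le> ennreal (c powr p) * ennreal (A powr p)"
    using f assms by (intro mult_left_mono) (auto simp: ennroot_le_iff)
  also have "\<dots> = ennreal ((c * A) powr p)"
    using assms by (simp add: powr_mult ennreal_mult)
  finally show ?thesis
    using assms by (subst ennroot_le_iff) auto
qed

lemma ennroot_nn_integral_mono: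
  assumes "0 < p" "0 \<le> A" "\<And>x. 0 \<le> f x" "\<And>x. f x \<le> g x"
    and "ennroot p (\<integral>\<^sup>+ x. ennreal (g x powr p) \<partial>M) \<le> ennreal A"
  shows "ennroot p (\<integral>\<^sup>+ x. ennreal (f x powr p) \<partial>M) \<le> ennreal A"
proof -
  have "(\<integral>\<^sup>+ x. ennreal (f x powr p) \<partial>M) \<le> (\<integral>\<^sup>+ x. ennreal (g x powr p) \<partial>M)"
    using assms by (intro nn_integral_mono ennreal_leI powr_mono2) auto
  then show ?thesis
    using assms by (auto simp: ennroot_le_iff intro: order_trans)
qed

text \<open>Only an inequality, since \<open>f\<close> is arbitrary: this spares a measurability proof for the costs
  of a pushed-forward coupling.\<close>

lemma nn_integral_distr_le:
  assumes T: "T \<in> measurable M N"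
  shows "(\<integral>\<^sup>+ x. f x \<partial>distr M N T) \<le> (\<integral>\<^sup>+ x. f (T x) \<partial>M)"
  \<comment> \<open>A simple function below \<open>f\<close> is measurable, so the change of
    variables is exact for it. The supremum over such functions gives the bound.\<close>
  unfolding nn_integral_def[of "distr M N T"]
proof (safe intro!: SUP_least)
  fix g assume g: "simple_function (distr M N T) g" "g \<le> f"
  have "integral\<^sup>S (distr M N T) g = (\<integral>\<^sup>+ x. g x \<partial>distr M N T)"
    using g by (simp add: nn_integral_eq_simple_integral)
  also have "\<dots> = (\<integral>\<^sup>+ x. g (T x) \<partial>M)"
    using g borel_measurable_simple_function[OF g(1)] by (intro nn_integral_distr T) auto
  also have "\<dots> \<le> (\<integral>\<^sup>+ x. f (T x) \<partial>M)"
    using g by (intro nn_integral_mono) (auto simp: le_fun_def)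
  finally show "integral\<^sup>S (distr M N T) g \<le> (\<integral>\<^sup>+ x. f (T x) \<partial>M)" .
qed

section \<open>Continuous images of couplings\<close>

section \<open>Borel sets of topologies\<close>

lemma space_borel_of [simp]: "space (borel_of T) = topspace T"
  unfolding borel_of_def by (rule space_measure_of) (auto dest: openin_subset)

lemma sets_borel_of: "sets (borel_of T) = sigma_sets (topspace T) {U. openin T U}"
  unfolding borel_of_def by (rule sets_measure_of) (auto dest: openin_subset)

lemma borel_of_euclidean: "borel_of euclidean = borel"
  by (simp add: borel_of_def borel_def)

lemma measurable_continuous_map:
  assumes "continuous_map T T' f"
  shows "f \<in> measurable (borel_of T) (borel_of T')"
  unfolding borel_of_def[of T']
proof (rule measurable_measure_of)
  show "f \<in> space (borel_of T) \<rightarrow> topspace T'"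
    using assms by (auto simp: continuous_map_def)
  fix U assume "U \<in> {U. openin T' U}"
  then have "openin T (f -` U \<inter> topspace T)"
    using assms by (simp add: continuous_map_def vimage_def Int_def conj_commute)
  then show "f -` U \<inter> space (borel_of T) \<in> sets (borel_of T)"
    by (auto simp: sets_borel_of)
qed (auto dest: openin_subset)

lemma continuous_map_map_prod:
  assumes "continuous_map T S u" "continuous_map T' S' v"
  shows "continuous_map (prod_topology T T') (prod_topology S S') (map_prod u v)"
  using assms by (simp add: map_prod_def continuous_map_prod_top)

text \<open>Couplings live on the Borel sets of the product topology, so measurability of
  \<open>map_prod u v\<close> is derived from its continuity. The marginals come out right because
  \<open>fst\<close> after \<open>map_prod u v\<close> is \<open>u\<close> after \<open>fst\<close>,
  and likewise for \<open>snd\<close>.\<close>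

lemma couplings_distr:
  assumes u: "continuous_map T S u" and v: "continuous_map T' S' v"
    and h: "h \<in> couplings T T' \<mu> \<mu>'"
  shows "distr h (borel_of (prod_topology S S')) (map_prod u v)
      \<in> couplings S S' (distr \<mu> (borel_of S) u) (distr \<mu>' (borel_of S') v)"
proof -
  have sets: "sets h = sets (borel_of (prod_topology T T'))"
    and \<mu>: "\<mu> = distr h (borel_of T) fst" and \<mu>': "\<mu>' = distr h (borel_of T') snd"
    and "prob_space h"
    using h by (auto simp: couplings_def)
  note cong = measurable_cong_sets[OF sets refl]
  have uv: "map_prod u v \<in> measurable h (borel_of (prod_topology S S'))"
    unfolding cong by (intro measurable_continuous_map continuous_map_map_prod u v)
  have fst: "fst \<in> measurable (borel_of (prod_topology S S')) (borel_of S)"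
    "fst \<in> measurable h (borel_of T)"
    unfolding cong by (intro measurable_continuous_map continuous_map_fst)+
  have snd: "snd \<in> measurable (borel_of (prod_topology S S')) (borel_of S')"
    "snd \<in> measurable h (borel_of T')"
    unfolding cong by (intro measurable_continuous_map continuous_map_snd)+
  show ?thesis
    unfolding couplings_def \<mu> \<mu>'
    using prob_space.prob_space_distr[OF \<open>prob_space h\<close> uv]
    by (simp add: distr_distr[OF fst(1) uv] distr_distr[OF snd(1) uv]
        distr_distr[OF measurable_continuous_map[OF u] fst(2)]
        distr_distr[OF measurable_continuous_map[OF v] snd(2)] comp_def)
qed

section \<open>Tree distances expressed through connected sets in the underlying space\<close>

section \<open>The merge tree of a continuous function\<close>

lemma equiv_merge_rel: "equiv UNIV (merge_rel f)"
proof (rule equivI)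
  show "refl (merge_rel f)"
    by (auto simp: refl_on_def merge_rel_def sublevel_def)
  show "sym (merge_rel f)"
    by (auto simp: sym_def merge_rel_def intro: connected_component_sym)
  show "trans (merge_rel f)"
    by (auto simp: trans_def merge_rel_def intro: connected_component_trans)
qed auto

lemma mt_proj_in [simp]: "mt_proj f x \<in> merge_tree f"
  by (simp add: mt_proj_def merge_tree_def quotientI)

lemma merge_tree_eq_range: "merge_tree f = range (mt_proj f)"
  by (auto simp: mt_proj_def merge_tree_def quotient_def)

lemma mt_height_proj [simp]: "mt_height f (mt_proj f x) = f x"
proof -
  have "f ` mt_proj f x = {f x}"
    by (auto simp: mt_proj_def merge_rel_def sublevel_def intro!: image_eqI[of _ _ x])
  then show ?thesis
    by (simp add: mt_height_def)
qed

lemma mt_component_proj: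
  "mt_component f (mt_proj f x) = connected_component_set (sublevel f (f x)) x"
proof -
  have "connected_component_set (sublevel f (f y)) y = connected_component_set (sublevel f (f x)) x"
    if "y \<in> mt_proj f x" for y
    using that by (auto simp: mt_proj_def merge_rel_def
        intro: connected_component_trans connected_component_sym)
  moreover have "x \<in> mt_proj f x"
    by (simp add: mt_proj_def merge_rel_def sublevel_def)
  ultimately show ?thesis
    unfolding mt_component_def by blast
qed

text \<open>As \<open>x\<close> lies in its own component, \<open>\<alpha>(x) \<preceq> c\<close> holds iff the connected set \<open>C\<^sub>c\<close> contains \<open>x\<close>.\<close>

lemma mt_le_proj:
  "mt_le f (mt_proj f x) (mt_proj f z) \<longleftrightarrow> connected_component (sublevel f (f z)) z x"
proof
  assume "mt_le f (mt_proj f x) (mt_proj f z)"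
  then show "connected_component (sublevel f (f z)) z x"
    using connected_component_refl[of x "sublevel f (f x)"]
    by (auto simp: mt_le_def mt_component_proj sublevel_def simp del: connected_component_refl_eq)
next
  assume *: "connected_component (sublevel f (f z)) z x"
  then have "f x \<le> f z"
    by (auto dest: connected_component_in simp: sublevel_def)
  then have "connected_component_set (sublevel f (f x)) x
      \<subseteq> connected_component_set (sublevel f (f z)) x"
    by (intro connected_component_mono) (auto simp: sublevel_def)
  also have "\<dots> = connected_component_set (sublevel f (f z)) z"
    using * by (metis connected_component_eq mem_Collect_eq)
  finally show "mt_le f (mt_proj f x) (mt_proj f z)"
    by (simp add: mt_le_def mt_component_proj)
qed

lemma mt_upper_proj:
  "mt_upper f (mt_proj f x) (mt_proj f y) =
    mt_proj f ` {z. connected_component (sublevel f (f z)) z x \<and>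
                    connected_component (sublevel f (f z)) z y}"
  by (auto simp: mt_upper_def merge_tree_eq_range mt_le_proj)

text \<open>The larger of the two climbs to \<open>z\<close> starts at the lower point, which turns
  the maximum of differences into \<open>f z - min (f x) (f y)\<close>.\<close>

lemma mt_dist_proj:
  "mt_dist f (mt_proj f x) (mt_proj f y) =
    (INF z \<in> {z. connected_component (sublevel f (f z)) z x \<and>
                 connected_component (sublevel f (f z)) z y}. f z - min (f x) (f y))"
  unfolding mt_dist_def mt_upper_proj image_image mt_height_proj
  by (intro arg_cong[of _ _ Inf] image_cong) auto

lemma mt_dist_bdd_below:
  "bdd_below ((\<lambda>z. f z - min (f x) (f y)) ` {z. connected_component (sublevel f (f z)) z x \<and>
                 connected_component (sublevel f (f z)) z y})"
  by (rule bdd_belowI2[of _ 0]) (auto dest!: connected_component_in simp: sublevel_def)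

locale merge_tree_function =
  fixes f :: "'a::topological_space \<Rightarrow> real"
  assumes continuous: "continuous_on UNIV f"
    and connected: "connected (UNIV :: 'a set)"
    and locally_path_connected: "locally path_connected (UNIV :: 'a set)"
begin

text \<open>An open neighbourhood \<open>f < s'\<close> is locally path-connected, so points joined by a connected set
  with \<open>f \<le> s < s'\<close> are joined by a path below \<open>s'\<close>; its highest point is a common upper bound.\<close>

lemma ex_upper:
  assumes S: "connected S" "x \<in> S" "y \<in> S" and s: "\<And>z. z \<in> S \<Longrightarrow> f z < s"
  obtains z where "connected_component (sublevel f (f z)) z x"
    "connected_component (sublevel f (f z)) z y" "f z < s"
proof -
  define U where "U = {z. f z < s}"
  have "open U"
    using continuous unfolding U_def by (intro open_Collect_less) auto
  then have "locally path_connected U"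
    using locally_open_subset[OF locally_path_connected] by simp
  moreover have "connected_component U x y"
    using S s by (auto simp: connected_component_def U_def)
  ultimately have "path_component U x y"
    by (simp add: path_component_eq_connected_component)
  then obtain g where g: "path g" "path_image g \<subseteq> U" "pathstart g = x" "pathfinish g = y"
    by (auto simp: path_component_def)
  have "\<exists>z\<in>path_image g. \<forall>w\<in>path_image g. f w \<le> f z"
    using g(1) continuous
    by (intro continuous_attains_sup compact_path_image) (auto intro: continuous_on_subset)
  then obtain z where z: "z \<in> path_image g" "\<And>w. w \<in> path_image g \<Longrightarrow> f w \<le> f z"
    by blast
  have "connected_component (sublevel f (f z)) z w" if "w \<in> path_image g" for w
    using that z connected_path_image[OF g(1)]
    by (auto simp: connected_component_def sublevel_def intro!: exI[of _ "path_image g"])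
  then show ?thesis
    using that[of z] g z by (auto simp: U_def)
qed

text \<open>\<open>f\<close> is bounded on a path from \<open>x\<close> to \<open>y\<close>, so
  \<open>ex_upper\<close> applies to its image. Hence the real infimum in \<open>mt_dist\<close>
  runs over a nonempty set and is meaningful.\<close>

lemma ex_upper_UNIV:
  "{z. connected_component (sublevel f (f z)) z x \<and> connected_component (sublevel f (f z)) z y} \<noteq> {}"
proof -
  have "path_connected (UNIV :: 'a set)"
    using connected locally_path_connected
    by (metis connected_component_UNIV connected_component_eq_self UNIV_I
        path_component_eq_connected_component_set path_connected_component_set)
  then obtain g where g: "path g" "pathstart g = x" "pathfinish g = y"
    by (auto simp: path_connected_def)
  have "bounded (f ` path_image g)"
    using g(1) continuous
    by (intro compact_imp_bounded compact_continuous_image compact_path_image)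
      (auto intro: continuous_on_subset)
  then obtain B where "\<And>z. z \<in> path_image g \<Longrightarrow> \<bar>f z\<bar> \<le> B"
    by (auto simp: bounded_real)
  then have B: "f z < B + 1" if "z \<in> path_image g" for z
    using that by fastforce
  show ?thesis
    using ex_upper[OF connected_path_image[OF g(1)] _ _ B] g
      pathstart_in_path_image[of g] pathfinish_in_path_image[of g] by blast
qed

text \<open>With \<open>mt_dist_approx\<close> this replaces the tree order by connected sets, which
  can be united and reused for other functions. The slack \<open>e\<close> supplies the strict bound
  that \<open>ex_upper\<close> asks for.\<close>

lemma mt_dist_le:
  assumes S: "connected S" "x \<in> S" "y \<in> S" and s: "\<And>z. z \<in> S \<Longrightarrow> f z \<le> s"
  shows "mt_dist f (mt_proj f x) (mt_proj f y) \<le> s - min (f x) (f y)"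
proof (rule field_le_epsilon)
  fix e :: real assume "0 < e"
  then have "f z < s + e" if "z \<in> S" for z
    using s[OF that] by simp
  from ex_upper[OF S this] obtain z where "connected_component (sublevel f (f z)) z x"
    "connected_component (sublevel f (f z)) z y" "f z < s + e"
    by blast
  then show "mt_dist f (mt_proj f x) (mt_proj f y) \<le> s - min (f x) (f y) + e"
    unfolding mt_dist_proj by (intro cINF_lower2[OF mt_dist_bdd_below]) auto
qed

text \<open>The component below a nearly optimal common upper bound serves as
  \<open>S\<close>.\<close>

lemma mt_dist_approx:
  assumes "0 < e"
  obtains S s where "connected S" "x \<in> S" "y \<in> S" "\<And>z. z \<in> S \<Longrightarrow> f z \<le> s"
    "s - min (f x) (f y) < mt_dist f (mt_proj f x) (mt_proj f y) + e"
proof -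
  have "mt_dist f (mt_proj f x) (mt_proj f y) < mt_dist f (mt_proj f x) (mt_proj f y) + e"
    using assms by simp
  then obtain z where z: "connected_component (sublevel f (f z)) z x"
    "connected_component (sublevel f (f z)) z y"
    "f z - min (f x) (f y) < mt_dist f (mt_proj f x) (mt_proj f y) + e"
    unfolding mt_dist_proj cINF_less_iff[OF ex_upper_UNIV mt_dist_bdd_below] by auto
  show ?thesis
    using z connected_component_subset[of "sublevel f (f z)" z]
    by (intro that[of "connected_component_set (sublevel f (f z)) z" "f z"])
      (auto simp: sublevel_def)
qed

lemma pseudometric_on_mt_dist: "pseudometric_on (merge_tree f) (mt_dist f)"
proof -
  let ?d = "\<lambda>x y. mt_dist f (mt_proj f x) (mt_proj f y)"
  have nonneg: "0 \<le> ?d x y" for x y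
    unfolding mt_dist_proj using ex_upper_UNIV
    by (intro cINF_greatest) (auto dest!: connected_component_in simp: sublevel_def)
  moreover have "?d x x = 0" for x
    using mt_dist_le[of "{x}" x x "f x"] nonneg[of x x] by auto
  moreover have "?d x y = ?d y x" for x y
    unfolding mt_dist_proj by (simp add: conj_commute min.commute)
  moreover have "?d x z \<le> ?d x y + ?d y z" for x y z
  proof (rule field_le_epsilon)
    fix e :: real assume "0 < e"
    then obtain S s S' s' where
      S: "connected S" "x \<in> S" "y \<in> S" "\<And>w. w \<in> S \<Longrightarrow> f w \<le> s"
        "s - min (f x) (f y) < ?d x y + e / 2" and
      S': "connected S'" "y \<in> S'" "z \<in> S'" "\<And>w. w \<in> S' \<Longrightarrow> f w \<le> s'"
        "s' - min (f y) (f z) < ?d y z + e / 2"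
      using mt_dist_approx[of "e / 2" x y] mt_dist_approx[of "e / 2" y z] half_gt_zero by metis
    \<comment> \<open>The two sets meet in \<open>y\<close>, so their union joins \<open>x\<close>
      to \<open>z\<close> below \<open>max s s'\<close>. As \<open>f y\<close> is at most
      \<open>s\<close> and at most \<open>s'\<close>, the sum of the two distances absorbs this
      level.\<close>
    have "connected (S \<union> S')"
      using S(1,3) S'(1,2) by (intro connected_Un) auto
    then have "?d x z \<le> max s s' - min (f x) (f z)"
      using S(2,4) S'(3,4) by (intro mt_dist_le[of "S \<union> S'"]) (auto simp: le_max_iff_disj)
    then show "?d x z \<le> ?d x y + ?d y z + e"
      using S(2,3,5) S'(2,3,5) S(4)[of x] S(4)[of y] S'(4)[of y] S'(4)[of z] by linarith
  qed
  ultimately show ?thesis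
    unfolding pseudometric_on_def merge_tree_eq_range by blast
qed

end

text \<open>A connected set chosen for \<open>f\<close> also serves for \<open>g\<close>: its level
  rises by at most \<open>r\<close>, and the lower endpoint value drops by at most
  \<open>r\<close>.\<close>

lemma mt_dist_perturb:
  assumes "merge_tree_function f" "merge_tree_function g" "\<And>x. \<bar>f x - g x\<bar> \<le> r"
  shows "mt_dist g (mt_proj g x) (mt_proj g y) \<le> mt_dist f (mt_proj f x) (mt_proj f y) + 2 * r"
proof (rule field_le_epsilon)
  fix e :: real assume "0 < e"
  then obtain S s where S: "connected S" "x \<in> S" "y \<in> S" "\<And>w. w \<in> S \<Longrightarrow> f w \<le> s"
      "s - min (f x) (f y) < mt_dist f (mt_proj f x) (mt_proj f y) + e"
    using merge_tree_function.mt_dist_approx[OF assms(1)] by metis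
  have "g z \<le> s + r" if "z \<in> S" for z
    using S(4)[OF that] assms(3)[of z] by linarith
  then have "mt_dist g (mt_proj g x) (mt_proj g y) \<le> s + r - min (g x) (g y)"
    using S by (intro merge_tree_function.mt_dist_le[OF assms(2)]) auto
  then show "mt_dist g (mt_proj g x) (mt_proj g y)
      \<le> mt_dist f (mt_proj f x) (mt_proj f y) + 2 * r + e"
    using S(5) assms(3)[of x] assms(3)[of y] by linarith
qed

section \<open>Gromov-Hausdorff gluing along a correspondence\<close>

section \<open>Gluing pseudo-metrics\<close>

lemma pseudometric_onD:
  assumes "pseudometric_on Z d"
  shows "\<And>x y. x \<in> Z \<Longrightarrow> y \<in> Z \<Longrightarrow> 0 \<le> d x y"
    and "\<And>x. x \<in> Z \<Longrightarrow> d x x = 0"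
    and "\<And>x y. x \<in> Z \<Longrightarrow> y \<in> Z \<Longrightarrow> d x y = d y x"
    and "\<And>x y z. x \<in> Z \<Longrightarrow> y \<in> Z \<Longrightarrow> z \<in> Z \<Longrightarrow> d x z \<le> d x y + d y z"
  using assms unfolding pseudometric_on_def by blast+

text \<open>Every \<open>u i\<close> is joined to \<open>v i\<close> by a bridge of length
  \<open>r\<close>. Indexing the pairs by \<open>i\<close> allows non-injective \<open>u\<close> and
  \<open>v\<close>, such as quotient maps.\<close>

fun glue_dist :: "real \<Rightarrow> ('i \<Rightarrow> 'z) \<Rightarrow> ('i \<Rightarrow> 'w) \<Rightarrow> ('z \<Rightarrow> 'z \<Rightarrow> real) \<Rightarrow> ('w \<Rightarrow> 'w \<Rightarrow> real)
    \<Rightarrow> 'z + 'w \<Rightarrow> 'z + 'w \<Rightarrow> real" where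
  "glue_dist r u v d d' (Inl a) (Inl b) = d a b"
| "glue_dist r u v d d' (Inr a) (Inr b) = d' a b"
| "glue_dist r u v d d' (Inl a) (Inr b) = (INF i. d a (u i) + r + d' (v i) b)"
| "glue_dist r u v d d' (Inr b) (Inl a) = (INF i. d a (u i) + r + d' (v i) b)"

text \<open>A detour through the other space crosses two bridges. Their total length
  \<open>2 * r\<close> makes up for the distortion between \<open>d\<close> and \<open>d'\<close>,
  so it shortens no distance (\<open>tri3\<close>, \<open>tri4\<close>). The other mixed triangle
  inequalities use one bridge and the triangle inequality on one side.\<close>

lemma pseudometric_on_glue_dist:
  assumes d: "pseudometric_on Z d" and d': "pseudometric_on Z' d'"
    and u: "\<And>i. u i \<in> Z" and v: "\<And>i. v i \<in> Z'" and r: "0 \<le> r"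
    and le: "\<And>i j. \<bar>d (u i) (u j) - d' (v i) (v j)\<bar> \<le> 2 * r"
  shows "pseudometric_on (Z <+> Z') (glue_dist r u v d d')"
    and "\<And>a b i. a \<in> Z \<Longrightarrow> b \<in> Z' \<Longrightarrow> glue_dist r u v d d' (Inl a) (Inr b) \<le> d a (u i) + r + d' (v i) b"
proof -
  note D = pseudometric_onD[OF d] pseudometric_onD[OF d']
  define \<delta> where "\<delta> a b = (INF i. d a (u i) + r + d' (v i) b)" for a b
  have lb: "0 \<le> d a (u i) + r + d' (v i) b" if "a \<in> Z" "b \<in> Z'" for a b i
    using that u v r D by simp
  have bdd: "bdd_below (range (\<lambda>i. d a (u i) + r + d' (v i) b))" if "a \<in> Z" "b \<in> Z'" for a b
    using lb[OF that] by (rule bdd_belowI2)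
  have upper: "\<delta> a b \<le> d a (u i) + r + d' (v i) b" if "a \<in> Z" "b \<in> Z'" for a b i
    unfolding \<delta>_def using bdd[OF that] by (rule cINF_lower) simp
  then show "glue_dist r u v d d' (Inl a) (Inr b) \<le> d a (u i) + r + d' (v i) b"
    if "a \<in> Z" "b \<in> Z'" for a b i
    using that by (simp add: \<delta>_def)
  have approx: "\<exists>i. d a (u i) + r + d' (v i) b < \<delta> a b + e"
    if "a \<in> Z" "b \<in> Z'" "0 < e" for a b e
  proof -
    have "\<delta> a b < \<delta> a b + e"
      using that by simp
    then show ?thesis
      using cINF_less_iff[OF UNIV_not_empty bdd[OF that(1,2)]] unfolding \<delta>_def by blast
  qed
  have nonneg: "0 \<le> \<delta> a b" if "a \<in> Z" "b \<in> Z'" for a b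
    unfolding \<delta>_def using lb[OF that] by (intro cINF_greatest) auto
  have tri1: "\<delta> a c \<le> d a b + \<delta> b c" if "a \<in> Z" "b \<in> Z" "c \<in> Z'" for a b c
  proof (rule field_le_epsilon)
    fix e :: real assume "0 < e"
    then obtain i where "d b (u i) + r + d' (v i) c < \<delta> b c + e"
      using approx \<open>b \<in> Z\<close> \<open>c \<in> Z'\<close> by blast
    then show "\<delta> a c \<le> d a b + \<delta> b c + e"
      using upper[of a c i] D(4)[of a b "u i"] that u by auto
  qed
  have tri2: "\<delta> a c \<le> \<delta> a b + d' b c" if "a \<in> Z" "b \<in> Z'" "c \<in> Z'" for a b c
  proof (rule field_le_epsilon)
    fix e :: real assume "0 < e"
    then obtain i where "d a (u i) + r + d' (v i) b < \<delta> a b + e"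
      using approx \<open>a \<in> Z\<close> \<open>b \<in> Z'\<close> by blast
    then show "\<delta> a c \<le> \<delta> a b + d' b c + e"
      using upper[of a c i] D(8)[of "v i" b c] that v by auto
  qed
  have tri3: "d a b \<le> \<delta> a c + \<delta> b c" if abc: "a \<in> Z" "b \<in> Z" "c \<in> Z'" for a b c
  proof (rule field_le_epsilon)
    fix e :: real assume "0 < e"
    then obtain i j where
      "d a (u i) + r + d' (v i) c < \<delta> a c + e / 2" "d b (u j) + r + d' (v j) c < \<delta> b c + e / 2"
      using approx[OF abc(1,3), of "e / 2"] approx[OF abc(2,3), of "e / 2"] by auto
    moreover have "d a b \<le> d a (u i) + d (u i) (u j) + d b (u j)"
      using D(4)[of a "u i" b] D(4)[of "u i" "u j" b] D(3)[of b "u j"] that u by auto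
    moreover have "d (u i) (u j) \<le> 2 * r + (d' (v i) c + d' (v j) c)"
      using le[of i j] D(8)[of "v i" c "v j"] D(7)[of c "v j"] that v by auto
    ultimately show "d a b \<le> \<delta> a c + \<delta> b c + e"
      by linarith
  qed
  have tri4: "d' a b \<le> \<delta> c a + \<delta> c b" if abc: "a \<in> Z'" "b \<in> Z'" "c \<in> Z" for a b c
  proof (rule field_le_epsilon)
    fix e :: real assume "0 < e"
    then obtain i j where
      "d c (u i) + r + d' (v i) a < \<delta> c a + e / 2" "d c (u j) + r + d' (v j) b < \<delta> c b + e / 2"
      using approx[OF abc(3,1), of "e / 2"] approx[OF abc(3,2), of "e / 2"] by auto
    moreover have "d' a b \<le> d' (v i) a + d' (v i) (v j) + d' (v j) b"
      using D(8)[of a "v i" b] D(8)[of "v i" "v j" b] D(7)[of a "v i"] that v by auto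
    moreover have "d' (v i) (v j) \<le> 2 * r + (d c (u i) + d c (u j))"
      using le[of i j] D(4)[of "u i" c "u j"] D(3)[of c "u i"] that u by auto
    ultimately show "d' a b \<le> \<delta> c a + \<delta> c b + e"
      by linarith
  qed
  have glue: "glue_dist r u v d d' (Inl a) (Inr b) = \<delta> a b"
    "glue_dist r u v d d' (Inr b) (Inl a) = \<delta> a b" for a b
    by (simp_all add: \<delta>_def)
  have sym: "glue_dist r u v d d' x y = glue_dist r u v d d' y x"
    if "x \<in> Z <+> Z'" "y \<in> Z <+> Z'" for x y
    using that D(3,7) by auto
  \<comment> \<open>Mirrored forms of \<open>tri1\<close> and \<open>tri2\<close>, for triangles
    traversed in the opposite direction.\<close>
  have tri1': "\<delta> a c \<le> \<delta> b c + d b a" if "a \<in> Z" "b \<in> Z" "c \<in> Z'" for a b c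
    using tri1[OF that] D(3)[of a b] that by simp
  have tri2': "\<delta> a c \<le> d' c b + \<delta> a b" if "a \<in> Z" "b \<in> Z'" "c \<in> Z'" for a b c
    using tri2[OF that] D(7)[of b c] that by simp
  have tri: "glue_dist r u v d d' x z \<le> glue_dist r u v d d' x y + glue_dist r u v d d' y z"
    if "x \<in> Z <+> Z'" "y \<in> Z <+> Z'" "z \<in> Z <+> Z'" for x y z
    using that by (auto simp: glue simp del: glue_dist.simps(3,4)
        intro: D(4,8) tri1 tri1' tri2 tri2' tri3 tri4)
  show "pseudometric_on (Z <+> Z') (glue_dist r u v d d')"
    unfolding pseudometric_on_def
  proof (intro conjI ballI)
    fix x y assume "x \<in> Z <+> Z'" "y \<in> Z <+> Z'"
    then show "0 \<le> glue_dist r u v d d' x y"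
      using D(1,5) nonneg by (auto simp: glue simp del: glue_dist.simps(3,4))
  qed (use D(2,6) in \<open>auto intro: sym tri\<close>)
qed

section \<open>Lipschitz dependence of \<sigma> on the point and on the measure\<close>

section \<open>Deviation functions\<close>

lemma admissibleD:
  assumes "admissible L \<theta>"
  shows "0 \<le> \<theta> x y" "\<theta> x x = 0" "\<theta> x y = \<theta> y x" "\<theta> x z \<le> \<theta> x y + \<theta> y z" "\<theta> x y \<le> L * dist x y"
  using assms unfolding admissible_def pseudometric_on_def by blast+

text \<open>By the triangle inequality \<open>\<theta> x\<close> varies by at most
  \<open>\<theta> y z\<close>, hence is \<open>L\<close>-Lipschitz for the original metric.\<close>

lemma borel_measurable_admissible:
  assumes adm: "admissible L \<theta>" and "0 \<le> L" and "sets M = sets borel"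
  shows "\<theta> x \<in> borel_measurable M"
proof -
  have "L-lipschitz_on UNIV (\<theta> x)"
  proof (rule lipschitz_onI)
    fix y z
    show "dist (\<theta> x y) (\<theta> x z) \<le> L * dist y z"
      using admissibleD(4)[OF adm, of x y z] admissibleD(4)[OF adm, of x z y]
        admissibleD(3,5)[OF adm, of y z]
      by (auto simp: dist_real_def)
  qed fact
  then have "\<theta> x \<in> borel_measurable borel"
    by (intro borel_measurable_continuous_onI lipschitz_on_continuous_on)
  then show ?thesis
    by (simp add: measurable_cong_sets[OF assms(3) refl])
qed

text \<open>The Bochner integral in \<open>deviation\<close> defaults to 0 for a non-integrable
  function, so finiteness has to be shown first. It follows by Minkowski from \<theta>(x, y) \<le> L
  (d(x, x0) + d(x0, y)) and the finite moment at \<open>x0\<close>.\<close>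

lemma ennreal_deviation:
  fixes \<mu> :: "'a::metric_space measure"
  assumes adm: "admissible L \<theta>" and "0 \<le> L" and "1 \<le> p" and \<mu>: "\<mu> \<in> finite_moment_measures p"
  shows "ennreal (deviation p \<theta> \<mu> x) = ennroot p (\<integral>\<^sup>+ y. ennreal (\<theta> x y powr p) \<partial>\<mu>)"
proof -
  let ?I = "\<integral>\<^sup>+ y. ennreal (\<theta> x y powr p) \<partial>\<mu>"
  obtain x0 where x0: "(\<integral>\<^sup>+ y. ennreal (dist x0 y powr p) \<partial>\<mu>) < \<infinity>"
    and "prob_space \<mu>" and sets: "sets \<mu> = sets borel"
    using \<mu> by (auto simp: finite_moment_measures_def)
  have [measurable]: "dist x0 \<in> borel_measurable \<mu>" "\<theta> x \<in> borel_measurable \<mu>"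
    using borel_measurable_admissible[OF adm \<open>0 \<le> L\<close> sets]
    by (auto simp: measurable_cong_sets[OF sets refl]
        intro!: borel_measurable_continuous_onI continuous_intros)
  define B where "B = enn2real (ennroot p (\<integral>\<^sup>+ y. ennreal (dist x0 y powr p) \<partial>\<mu>))"
  have "ennroot p (\<integral>\<^sup>+ y. ennreal (dist x0 y powr p) \<partial>\<mu>) \<le> ennreal B"
    using x0 by (simp add: B_def ennroot_def)
  then have "ennroot p (\<integral>\<^sup>+ y. ennreal ((dist x x0 + dist x0 y) powr p) \<partial>\<mu>) \<le> ennreal (dist x x0 + B)"
    using \<open>1 \<le> p\<close> \<open>prob_space \<mu>\<close>
    by (intro ennroot_nn_integral_add_le ennroot_nn_integral_const) (auto simp: B_def)
  then have "ennroot p (\<integral>\<^sup>+ y. ennreal ((L * (dist x x0 + dist x0 y)) powr p) \<partial>\<mu>)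
      \<le> ennreal (L * (dist x x0 + B))"
    using \<open>1 \<le> p\<close> \<open>0 \<le> L\<close> by (intro ennroot_nn_integral_cmult) (auto simp: B_def)
  then have "ennroot p ?I \<le> ennreal (L * (dist x x0 + B))"
  proof (rule ennroot_nn_integral_mono[rotated -1])
    show "\<theta> x y \<le> L * (dist x x0 + dist x0 y)" for y
      using admissibleD(5)[OF adm, of x y] mult_left_mono[OF dist_triangle[of x y x0] \<open>0 \<le> L\<close>]
      by linarith
  qed (use \<open>1 \<le> p\<close> \<open>0 \<le> L\<close> admissibleD[OF adm] in \<open>auto simp: B_def\<close>)
  then have "?I \<noteq> \<infinity>"
    by (auto simp: ennroot_def top_unique)
  moreover have "(\<integral>y. \<theta> x y powr p \<partial>\<mu>) = enn2real ?I"
    by (intro integral_eq_nn_integral) auto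
  ultimately show ?thesis
    by (simp add: deviation_def ennroot_def)
qed

lemma deviation_nonneg: "0 \<le> deviation p \<theta> \<mu> x"
  by (simp add: deviation_def)

text \<open>Minkowski's inequality for \<open>\<theta> y\<close> plus the constant
  \<open>L * dist x y\<close>, whose norm under a probability measure is at most itself.\<close>

lemma deviation_le_add:
  fixes \<mu> :: "'a::metric_space measure"
  assumes adm: "admissible L \<theta>" and "0 \<le> L" and "1 \<le> p" and \<mu>: "\<mu> \<in> finite_moment_measures p"
  shows "deviation p \<theta> \<mu> x \<le> deviation p \<theta> \<mu> y + L * dist x y"
proof -
  have "prob_space \<mu>" and sets: "sets \<mu> = sets borel"
    using \<mu> by (auto simp: finite_moment_measures_def)
  have [measurable]: "\<theta> y \<in> borel_measurable \<mu>"
    by (rule borel_measurable_admissible[OF adm \<open>0 \<le> L\<close> sets])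
  have "ennroot p (\<integral>\<^sup>+ z. ennreal ((\<theta> y z + L * dist x y) powr p) \<partial>\<mu>)
      \<le> ennreal (deviation p \<theta> \<mu> y + L * dist x y)"
    using \<open>1 \<le> p\<close> \<open>0 \<le> L\<close> \<open>prob_space \<mu>\<close> admissibleD(1)[OF adm] ennreal_deviation[OF assms]
    by (intro ennroot_nn_integral_add_le ennroot_nn_integral_const) (auto simp: deviation_nonneg)
  then have "ennroot p (\<integral>\<^sup>+ z. ennreal (\<theta> x z powr p) \<partial>\<mu>)
      \<le> ennreal (deviation p \<theta> \<mu> y + L * dist x y)"
  proof (rule ennroot_nn_integral_mono[rotated -1])
    show "\<theta> x z \<le> \<theta> y z + L * dist x y" for z
      using admissibleD(4)[OF adm, of x z y] admissibleD(5)[OF adm, of x y] by linarith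
  qed (use \<open>1 \<le> p\<close> \<open>0 \<le> L\<close> admissibleD[OF adm] in \<open>auto simp: deviation_nonneg\<close>)
  then show ?thesis
    using \<open>0 \<le> L\<close> by (simp add: ennreal_deviation[OF assms, symmetric] deviation_nonneg
        ennreal_le_iff del: ennreal_plus)
qed

text \<open>Stated for two maps on a common space, so that the projections of a coupling can be
  inserted in either order to bound the difference on both sides.\<close>

lemma deviation_distr_le:
  fixes M :: "'b measure" and u v :: "'b \<Rightarrow> 'a::polish_space"
  assumes adm: "admissible L \<theta>" and "0 \<le> L" and "1 \<le> p"
    and [measurable]: "u \<in> borel_measurable M" "v \<in> borel_measurable M"
    and mom: "distr M borel u \<in> finite_moment_measures p" "distr M borel v \<in> finite_moment_measures p"
    and "0 \<le> W" and W: "ennroot p (\<integral>\<^sup>+ z. ennreal (dist (u z) (v z) powr p) \<partial>M) \<le> ennreal W"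
  shows "deviation p \<theta> (distr M borel v) x \<le> deviation p \<theta> (distr M borel u) x + L * W"
proof -
  have [measurable]: "\<theta> x \<in> borel_measurable borel"
    by (rule borel_measurable_admissible[OF adm \<open>0 \<le> L\<close> refl])
  have dev: "ennreal (deviation p \<theta> (distr M borel w) x)
      = ennroot p (\<integral>\<^sup>+ z. ennreal (\<theta> x (w z) powr p) \<partial>M)"
    if "w \<in> borel_measurable M" "distr M borel w \<in> finite_moment_measures p" for w :: "'b \<Rightarrow> 'a"
    using that ennreal_deviation[OF adm \<open>0 \<le> L\<close> \<open>1 \<le> p\<close> that(2), of x]
    by (simp add: nn_integral_distr)
  have "ennroot p (\<integral>\<^sup>+ z. ennreal ((\<theta> x (u z) + L * dist (u z) (v z)) powr p) \<partial>M)
      \<le> ennreal (deviation p \<theta> (distr M borel u) x + L * W)"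
    using assms admissibleD(1)[OF adm] dev[OF _ mom(1)]
    by (intro ennroot_nn_integral_add_le ennroot_nn_integral_cmult) (auto simp: deviation_nonneg)
  then have "ennroot p (\<integral>\<^sup>+ z. ennreal (\<theta> x (v z) powr p) \<partial>M)
      \<le> ennreal (deviation p \<theta> (distr M borel u) x + L * W)"
  proof (rule ennroot_nn_integral_mono[rotated -1])
    show "\<theta> x (v z) \<le> \<theta> x (u z) + L * dist (u z) (v z)" for z
      using admissibleD(4)[OF adm, of x "v z" "u z"] admissibleD(5)[OF adm, of "u z" "v z"] by linarith
  qed (use assms admissibleD[OF adm] in \<open>auto simp: deviation_nonneg\<close>)
  then show ?thesis
    using assms by (simp add: dev[OF _ mom(2), symmetric] deviation_nonneg
        ennreal_le_iff del: ennreal_plus)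
qed

section \<open>Lipschitz projections, the estimate for one coupling, and the infimum over
  couplings\<close>

section \<open>Stability\<close>

text \<open>On a path staying within distance R of both \<open>x\<close> and \<open>y\<close>,
  \<open>f\<close> exceeds neither \<open>f x\<close> nor \<open>f y\<close> by more than L R. The
  infimum over paths need not be attained, hence R = K d(x, y) + e with \<open>e\<close> tending to
  0.\<close>

lemma mt_dist_le_connectivity:
  fixes f :: "'a::metric_space \<Rightarrow> real"
  assumes f: "merge_tree_function f" and "0 \<le> L" and lip: "\<And>x y. f x \<le> f y + L * dist x y"
    and K: "connectivity_constant TYPE('a) K"
  shows "mt_dist f (mt_proj f x) (mt_proj f y) \<le> L * (K * dist x y)"
proof -
  have *: "mt_dist f (mt_proj f x) (mt_proj f y) \<le> L * (K * dist x y + e)" if "0 < e" for e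
  proof -
    have "0 < K" "path_radius x y \<le> ennreal (K * dist x y)"
      using K by (auto simp: connectivity_constant_def)
    moreover from this \<open>0 < e\<close> have "ennreal (K * dist x y) < ennreal (K * dist x y + e)"
      by (intro ennreal_lessI) (auto intro: add_nonneg_pos)
    ultimately have "path_radius x y < ennreal (K * dist x y + e)"
      by (metis le_less_trans)
    then obtain g where g: "path g" "pathstart g = x" "pathfinish g = y"
      and sup: "(SUP t\<in>{0..1}. ennreal (max (dist x (g t)) (dist (g t) y))) < ennreal (K * dist x y + e)"
      by (auto simp: path_radius_def INF_less_iff)
    have "f z \<le> min (f x) (f y) + L * (K * dist x y + e)" if z: "z \<in> path_image g" for z
    proof -
      obtain t where t: "t \<in> {0..1}" "z = g t"
        using z unfolding path_image_def by blast
      have "ennreal (max (dist x z) (dist z y))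
          \<le> (SUP t\<in>{0..1}. ennreal (max (dist x (g t)) (dist (g t) y)))"
        unfolding t(2) by (rule SUP_upper[OF t(1)])
      also note sup
      finally have "max (dist x z) (dist z y) < K * dist x y + e"
        by (subst (asm) ennreal_less_iff) (auto simp: le_max_iff_disj)
      then have "L * dist z x \<le> L * (K * dist x y + e)" "L * dist z y \<le> L * (K * dist x y + e)"
        using \<open>0 \<le> L\<close> by (auto simp: dist_commute intro: mult_left_mono)
      then show ?thesis
        using lip[of z x] lip[of z y] by linarith
    qed
    moreover have "x \<in> path_image g" "y \<in> path_image g"
      using g(2,3) pathstart_in_path_image[of g] pathfinish_in_path_image[of g] by simp_all
    ultimately have "mt_dist f (mt_proj f x) (mt_proj f y)
        \<le> min (f x) (f y) + L * (K * dist x y + e) - min (f x) (f y)"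
      by (intro merge_tree_function.mt_dist_le[OF f connected_path_image[OF g(1)]])
    then show ?thesis
      by simp
  qed
  show ?thesis
  proof (rule tendsto_lowerbound)
    show "((\<lambda>e. L * (K * dist x y + e)) \<longlongrightarrow> L * (K * dist x y)) (at_right 0)"
      by (auto intro!: tendsto_eq_intros)
    show "\<forall>\<^sub>F e in at_right 0. mt_dist f (mt_proj f x) (mt_proj f y) \<le> L * (K * dist x y + e)"
      using * by (auto simp: eventually_at_filter)
  qed simp
qed

lemma continuous_map_mt_proj:
  fixes f :: "'a::metric_space \<Rightarrow> real"
  assumes "0 \<le> C" and le: "\<And>x y. mt_dist f (mt_proj f x) (mt_proj f y) \<le> C * dist x y"
  shows "continuous_map euclidean (pm_topology (merge_tree f) (mt_dist f)) (mt_proj f)"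
  unfolding continuous_map
proof (intro conjI allI impI)
  fix U assume "openin (pm_topology (merge_tree f) (mt_dist f)) U"
  then have U: "\<And>a. a \<in> U \<Longrightarrow> \<exists>e>0. \<forall>b\<in>merge_tree f. mt_dist f a b < e \<longrightarrow> b \<in> U"
    by (auto simp: openin_pm_topology)
  have "open {x. mt_proj f x \<in> U}"
    unfolding open_dist
  proof
    fix x assume "x \<in> {x. mt_proj f x \<in> U}"
    then obtain e where e: "0 < e" "\<And>y. mt_dist f (mt_proj f x) (mt_proj f y) < e \<Longrightarrow> mt_proj f y \<in> U"
      using U[of "mt_proj f x"] by auto
    \<comment> \<open>Dividing by \<open>C + 1\<close> keeps the radius well defined when
      \<open>C\<close> is 0.\<close>
    have "mt_proj f y \<in> U" if "dist y x < e / (C + 1)" for y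
    proof (rule e)
      have "C * dist x y \<le> (C + 1) * dist x y"
        by (simp add: mult_right_mono)
      also have "\<dots> < e"
        using that \<open>0 \<le> C\<close> by (simp add: dist_commute field_simps)
      finally show "mt_dist f (mt_proj f x) (mt_proj f y) < e"
        using le[of x y] by linarith
    qed
    moreover have "0 < e / (C + 1)"
      using e \<open>0 \<le> C\<close> by simp
    ultimately show "\<exists>e>0. \<forall>y. dist y x < e \<longrightarrow> y \<in> {x. mt_proj f x \<in> U}"
      by blast
  qed
  then show "openin euclidean {x \<in> topspace euclidean. mt_proj f x \<in> U}"
    by simp
qed auto

lemma D_KS_bmt_le_coupling:
  fixes \<theta> :: "'a::polish_space \<Rightarrow> 'a \<Rightarrow> real"
  assumes conn: "connected (UNIV :: 'a set)" and lpc: "locally path_connected (UNIV :: 'a set)"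
    and "1 \<le> p" and "0 \<le> L" and adm: "admissible L \<theta>"
    and mom: "\<mu> \<in> finite_moment_measures p" "\<mu>' \<in> finite_moment_measures p"
    and "1 \<le> K" and K: "connectivity_constant TYPE('a) K"
    and h: "h \<in> couplings euclidean euclidean \<mu> \<mu>'"
    and "0 \<le> W" and W: "ennroot p (\<integral>\<^sup>+ z. ennreal (dist (fst z) (snd z) powr p) \<partial>h) \<le> ennreal W"
  shows "D_KS p (bmt p \<theta> \<mu>) (bmt p \<theta> \<mu>') \<le> ennreal (L * (1 + K) * W)"
proof -
  define f where "f = deviation p \<theta> \<mu>"
  define g where "g = deviation p \<theta> \<mu>'"
  define r where "r = L * W"
  have "0 \<le> r"
    using \<open>0 \<le> L\<close> \<open>0 \<le> W\<close> by (simp add: r_def)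
  have "prob_space h" and sets: "sets h = sets borel"
    and \<mu>: "distr h borel fst = \<mu>" and \<mu>': "distr h borel snd = \<mu>'"
    using h by (auto simp: couplings_def borel_of_euclidean euclidean_product_topology)
  have [measurable]: "fst \<in> borel_measurable h" "snd \<in> borel_measurable h"
    unfolding measurable_cong_sets[OF sets refl]
    by (auto intro!: borel_measurable_continuous_onI continuous_intros)

  have lip: "f x \<le> f y + L * dist x y" "g x \<le> g y + L * dist x y" for x y
    unfolding f_def g_def
    using deviation_le_add[OF adm \<open>0 \<le> L\<close> \<open>1 \<le> p\<close>] mom by auto
  have "continuous_on UNIV k" if "\<And>x y. k x \<le> k y + L * dist x y" for k :: "'a \<Rightarrow> real"
  proof -
    have "L-lipschitz_on UNIV k"
    proof (rule lipschitz_onI)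
      fix x y show "dist (k x) (k y) \<le> L * dist x y"
        using that[of x y] that[of y x] by (auto simp: dist_real_def dist_commute)
    qed fact
    then show ?thesis
      by (rule lipschitz_on_continuous_on)
  qed
  then have f: "merge_tree_function f" and g: "merge_tree_function g"
    using lip conn lpc by (auto simp: merge_tree_function_def)
  \<comment> \<open>The two projections of \<open>h\<close> are used in both orders.\<close>
  have fg: "\<bar>f x - g x\<bar> \<le> r" for x
    using deviation_distr_le[OF adm \<open>0 \<le> L\<close> \<open>1 \<le> p\<close>, of fst h snd W x]
      deviation_distr_le[OF adm \<open>0 \<le> L\<close> \<open>1 \<le> p\<close>, of snd h fst W x] W \<open>0 \<le> W\<close>
    by (auto simp: \<mu> \<mu>' mom f_def g_def r_def dist_commute)
  have "0 \<le> L * K"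
    using \<open>0 \<le> L\<close> \<open>1 \<le> K\<close> by simp
  have df: "mt_dist f (mt_proj f x) (mt_proj f y) \<le> L * K * dist x y"
    and dg: "mt_dist g (mt_proj g x) (mt_proj g y) \<le> L * K * dist x y" for x y
    using mt_dist_le_connectivity[OF f \<open>0 \<le> L\<close> lip(1) K]
      mt_dist_le_connectivity[OF g \<open>0 \<le> L\<close> lip(2) K] by (auto simp: mult.assoc)

  define F where "F = bmt p \<theta> \<mu>"
  define G where "G = bmt p \<theta> \<mu>'"
  have F: "fmm_pts F = merge_tree f" "fmm_dist F = mt_dist f" "fmm_fun F = mt_height f"
    "fmm_meas F = distr \<mu> (borel_of (fmm_top F)) (mt_proj f)"
    by (auto simp: F_def f_def bmt_def Let_def fmm_top_def)
  have G: "fmm_pts G = merge_tree g" "fmm_dist G = mt_dist g" "fmm_fun G = mt_height g"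
    "fmm_meas G = distr \<mu>' (borel_of (fmm_top G)) (mt_proj g)"
    by (auto simp: G_def g_def bmt_def Let_def fmm_top_def)
  define \<delta> where "\<delta> = glue_dist r (mt_proj f) (mt_proj g) (mt_dist f) (mt_dist g)"
  have "\<bar>mt_dist f (mt_proj f x) (mt_proj f y) - mt_dist g (mt_proj g x) (mt_proj g y)\<bar> \<le> 2 * r" for x y
    using mt_dist_perturb[OF f g fg, of x y] mt_dist_perturb[OF g f, of r x y] fg
    by (auto simp: abs_minus_commute)
  note glue = pseudometric_on_glue_dist[where u = "mt_proj f" and v = "mt_proj g",
      OF merge_tree_function.pseudometric_on_mt_dist[OF f]
      merge_tree_function.pseudometric_on_mt_dist[OF g] mt_proj_in mt_proj_in \<open>0 \<le> r\<close> this,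
      folded \<delta>_def]
  \<comment> \<open>\<open>\<delta>\<close> extends the distances of the whole trees, in particular
    those on the supports.\<close>
  have \<delta>: "\<delta> \<in> metric_couplings F G"
    using glue(1) by (simp add: metric_couplings_def F G \<delta>_def)
  have \<delta>_nonneg: "0 \<le> \<delta> (Inl (mt_proj f x)) (Inr (mt_proj g y))" for x y
    by (intro pseudometric_onD(1)[OF glue(1)] InlI InrI mt_proj_in)
  \<comment> \<open>Crossing the bridge at \<open>x\<close> costs nothing inside the first tree and
    leaves only the distance in the second.\<close>
  have \<delta>_le: "\<delta> (Inl (mt_proj f x)) (Inr (mt_proj g y)) \<le> r + L * K * dist x y" for x y
    using glue(2)[of "mt_proj f x" "mt_proj g y" x] dg[of x y]
      pseudometric_onD(2)[OF merge_tree_function.pseudometric_on_mt_dist[OF f], of "mt_proj f x"]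
    by simp
  \<comment> \<open>Since \<open>1 \<le> K\<close>, the Lipschitz bound for \<open>g\<close> is
    absorbed into the majorant already found for \<open>\<delta>\<close>.\<close>
  have height_le: "\<bar>f x - g y\<bar> \<le> r + L * K * dist x y" for x y
  proof -
    have "L * dist x y \<le> L * K * dist x y"
      using \<open>0 \<le> L\<close> \<open>1 \<le> K\<close> by (intro mult_right_mono) (auto simp: mult_le_cancel_left1)
    then show ?thesis
      using fg[of x] lip(2)[of x y] lip(2)[of y x] by (auto simp: dist_commute)
  qed

  let ?T = "map_prod (mt_proj f) (mt_proj g)"
  define h' where "h' = distr h (borel_of (prod_topology (fmm_top F) (fmm_top G))) ?T"
  have cont: "continuous_map euclidean (fmm_top F) (mt_proj f)"
    "continuous_map euclidean (fmm_top G) (mt_proj g)"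
    unfolding fmm_top_def F G
    using continuous_map_mt_proj[OF \<open>0 \<le> L * K\<close> df] continuous_map_mt_proj[OF \<open>0 \<le> L * K\<close> dg] by auto
  have h': "h' \<in> couplings (fmm_top F) (fmm_top G) (fmm_meas F) (fmm_meas G)"
    unfolding h'_def F(4) G(4) by (rule couplings_distr[OF cont h])
  have T: "?T \<in> measurable h (borel_of (prod_topology (fmm_top F) (fmm_top G)))"
    unfolding measurable_cong_sets[OF sets refl]
    using measurable_continuous_map[OF continuous_map_map_prod[OF cont]]
    by (simp add: euclidean_product_topology borel_of_euclidean)

  have bound: "ennroot p (\<integral>\<^sup>+ z. ennreal ((r + L * K * dist (fst z) (snd z)) powr p) \<partial>h)
      \<le> ennreal (r + L * K * W)"
    using \<open>1 \<le> p\<close> \<open>0 \<le> r\<close> \<open>0 \<le> L * K\<close> \<open>0 \<le> W\<close> W \<open>prob_space h\<close>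
    by (intro ennroot_nn_integral_add_le ennroot_nn_integral_const ennroot_nn_integral_cmult) auto
  \<comment> \<open>One estimate serves both costs in \<open>D_KS\<close>. Pulling back along
    \<open>?T\<close> evaluates \<open>c\<close> only at pairs of projected points, where the
    majorant is available.\<close>
  have cost: "ennroot p (\<integral>\<^sup>+ z. ennreal (c z powr p) \<partial>h') \<le> ennreal (r + L * K * W)"
    if c: "\<And>x y. 0 \<le> c (mt_proj f x, mt_proj g y)"
      "\<And>x y. c (mt_proj f x, mt_proj g y) \<le> r + L * K * dist x y" for c
  proof -
    have "ennroot p (\<integral>\<^sup>+ z. ennreal (c (?T z) powr p) \<partial>h) \<le> ennreal (r + L * K * W)"
      using \<open>1 \<le> p\<close> \<open>0 \<le> r\<close> \<open>0 \<le> L * K\<close> \<open>0 \<le> W\<close> c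
      by (intro ennroot_nn_integral_mono[OF _ _ _ _ bound]) (auto simp: map_prod_def case_prod_unfold)
    moreover have "(\<integral>\<^sup>+ z. ennreal (c z powr p) \<partial>h') \<le> (\<integral>\<^sup>+ z. ennreal (c (?T z) powr p) \<partial>h)"
      unfolding h'_def by (rule nn_integral_distr_le[OF T])
    ultimately show ?thesis
      using \<open>1 \<le> p\<close> \<open>0 \<le> r\<close> \<open>0 \<le> L * K\<close> \<open>0 \<le> W\<close>
      by (subst (asm) ennroot_le_iff, simp, simp, subst ennroot_le_iff) auto
  qed
  have "D_KS p F G
      \<le> max (ennroot p (\<integral>\<^sup>+ z. ennreal (\<delta> (Inl (fst z)) (Inr (snd z)) powr p) \<partial>h'))
            (ennroot p (\<integral>\<^sup>+ z. ennreal (\<bar>fmm_fun F (fst z) - fmm_fun G (snd z)\<bar> powr p) \<partial>h'))"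
    unfolding D_KS_def by (rule INF_lower2[OF h'], rule INF_lower[OF \<delta>])
  also have "\<dots> \<le> ennreal (r + L * K * W)"
    using cost[of "\<lambda>z. \<delta> (Inl (fst z)) (Inr (snd z))"]
      cost[of "\<lambda>z. \<bar>fmm_fun F (fst z) - fmm_fun G (snd z)\<bar>"]
    by (simp add: F(3) G(3) \<delta>_nonneg \<delta>_le height_le)
  also have "r + L * K * W = L * (1 + K) * W"
    by (simp add: r_def algebra_simps)
  finally show ?thesis
    by (simp add: F_def G_def)
qed

text \<open>Dividing by the positive constant first makes the claim a lower bound for every coupling
  cost, hence for their infimum. An infinite cost is trivial.\<close>

lemma D_KS_bmt_le_wasserstein:
  fixes \<theta> :: "'a::polish_space \<Rightarrow> 'a \<Rightarrow> real"
  assumes "connected (UNIV :: 'a set)" "locally path_connected (UNIV :: 'a set)"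
    and "1 \<le> p" "0 < L" "admissible L \<theta>"
    and "\<mu> \<in> finite_moment_measures p" "\<mu>' \<in> finite_moment_measures p"
    and "1 \<le> K" "connectivity_constant TYPE('a) K"
  shows "D_KS p (bmt p \<theta> \<mu>) (bmt p \<theta> \<mu>') \<le> ennreal (L * (1 + K)) * wasserstein p \<mu> \<mu>'"
proof -
  let ?D = "D_KS p (bmt p \<theta> \<mu>) (bmt p \<theta> \<mu>')"
  define C where "C = L * (1 + K)"
  have C: "0 < C"
    using assms by (simp add: C_def)
  have inv: "ennreal (1 / C) * ennreal C = 1"
    using C by (simp add: ennreal_mult[symmetric])
  have "ennreal (1 / C) * ?D \<le> wasserstein p \<mu> \<mu>'"
    unfolding wasserstein_def
  proof (rule INF_greatest)
    fix h assume h: "h \<in> couplings euclidean euclidean \<mu> \<mu>'"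
    let ?W = "ennroot p (\<integral>\<^sup>+ z. ennreal (dist (fst z) (snd z) powr p) \<partial>h)"
    show "ennreal (1 / C) * ?D \<le> ?W"
    proof (cases ?W)
      case (real w)
      then have "?D \<le> ennreal (C * w)"
        using assms unfolding C_def by (intro D_KS_bmt_le_coupling[OF _ _ _ _ _ _ _ _ _ h]) auto
      then have "ennreal (1 / C) * ?D \<le> ennreal (1 / C) * ennreal (C * w)"
        by (intro mult_left_mono) auto
      also have "\<dots> = ?W"
        using C real by (simp add: ennreal_mult[symmetric])
      finally show ?thesis .
    qed simp
  qed
  then have "ennreal C * (ennreal (1 / C) * ?D) \<le> ennreal C * wasserstein p \<mu> \<mu>'"
    by (intro mult_left_mono) auto
  moreover have "ennreal C * (ennreal (1 / C) * ?D) = ?D"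
    using inv by (metis mult.assoc mult.commute mult_1)
  ultimately show ?thesis
    by (simp only: C_def)
qed

text \<open>The geodesic itself is the path: the distances from its points to either end are
  fractions of d(x, y).\<close>

lemma geodesic_space_connectivity_constant:
  assumes "geodesic_space TYPE('a::metric_space)"
  shows "connectivity_constant TYPE('a) 1"
  unfolding connectivity_constant_def
proof (intro conjI allI)
  fix x y :: 'a
  obtain g :: "real \<Rightarrow> 'a" where g: "g 0 = x" "g 1 = y"
    and dist: "\<And>s t. s \<in> {0..1} \<Longrightarrow> t \<in> {0..1} \<Longrightarrow> dist (g s) (g t) = \<bar>s - t\<bar> * dist x y"
    using assms unfolding geodesic_space_def by blast
  have "(dist x y)-lipschitz_on {0..1} g"
    by (rule lipschitz_onI) (auto simp: dist dist_real_def mult.commute)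
  then have "path g"
    by (simp add: path_def lipschitz_on_continuous_on)
  have "dist x (g t) \<le> dist x y" "dist (g t) y \<le> dist x y" if "t \<in> {0..1}" for t
    using dist[of 0 t] dist[of t 1] that g by (auto intro!: mult_left_le_one_le)
  then have "(SUP t\<in>{0..1}. ennreal (max (dist x (g t)) (dist (g t) y))) \<le> ennreal (1 * dist x y)"
    by (intro SUP_least ennreal_leI) auto
  then show "path_radius x y \<le> ennreal (1 * dist x y)"
    unfolding path_radius_def using \<open>path g\<close> g
    by (intro INF_lower2[of g]) (auto simp: pathstart_def pathfinish_def)
qed simp

theorem theorem4p5:
  fixes \<theta> :: "'a::polish_space \<Rightarrow> 'a \<Rightarrow> real"
    and \<mu> \<mu>' :: "'a measure"
    and p L :: real
  assumes "connected (UNIV :: 'a set)"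
    and "locally path_connected (UNIV :: 'a set)"
    and "p \<ge> 1"
    and "L > 0"
    and "admissible L \<theta>"
    and "\<mu> \<in> finite_moment_measures p"
    and "\<mu>' \<in> finite_moment_measures p"
  shows "(\<forall>K. K \<ge> 1 \<and> connectivity_constant TYPE('a) K \<longrightarrow>
            D_KS p (bmt p \<theta> \<mu>) (bmt p \<theta> \<mu>')
              \<le> ennreal (L * (1 + K)) * wasserstein p \<mu> \<mu>') \<and>
         (geodesic_space TYPE('a) \<and> \<theta> = dist \<longrightarrow>
            D_KS p (bmt p \<theta> \<mu>) (bmt p \<theta> \<mu>') \<le> 2 * wasserstein p \<mu> \<mu>')"
proof (intro conjI allI impI; elim conjE)
  fix K assume "K \<ge> 1" "connectivity_constant TYPE('a) K"
  then show "D_KS p (bmt p \<theta> \<mu>) (bmt p \<theta> \<mu>') \<le> ennreal (L * (1 + K)) * wasserstein p \<mu> \<mu>'"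
    using assms by (intro D_KS_bmt_le_wasserstein)
next
  assume "geodesic_space TYPE('a)" and \<theta>: "\<theta> = dist"
  then have K: "connectivity_constant TYPE('a) 1"
    by (intro geodesic_space_connectivity_constant)
  \<comment> \<open>The metric is 1-admissible, so the general bound is applied with 1 in place of
    both \<open>L\<close> and \<open>K\<close>, which gives the constant 2.\<close>
  have adm: "admissible 1 \<theta>"
    unfolding \<theta> by (auto simp: admissible_def pseudometric_on_def dist_commute dist_triangle)
  have "D_KS p (bmt p \<theta> \<mu>) (bmt p \<theta> \<mu>') \<le> ennreal (1 * (1 + 1)) * wasserstein p \<mu> \<mu>'"
    using assms by (intro D_KS_bmt_le_wasserstein adm K) auto
  then show "D_KS p (bmt p \<theta> \<mu>) (bmt p \<theta> \<mu>') \<le> 2 * wasserstein p \<mu> \<mu>'"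
    by simp
qed

end
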